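(* The three-party AND protocol described in the context is correct: for all bits $a,b\in\{0,1\}$ and all keys $K_a,K_b,K_2,K_5,K_6,K_7,K_8\in\{0,1\}$, decrypting the EVH's final value with the KH's final key $K_f$ yields $a\wedge b$, i.e. $$DEC_{K_f}\big(t_0\oplus (K_5\wedge K_6)\oplus ENC_{K_7}(t_4)\oplus K_8\big)=a\wedge b .$$
   Context: For bits $m,K,c\in\{0,1\}$: $ENC_K(m):=K\oplus m$ and $DEC_K(c):=c\oplus K$, where $\oplus$ is XOR and $\wedge$ is AND ($\wedge$ binds tighter than $\oplus$). Three-party protocol for the AND of two secret bits $a,b$. Parties: a key holder (KH), an encrypted value holder (EVH), and one helper. Initially the EVH holds $ENC_{K_a}(a)$ and $ENC_{K_b}(b)$, and the KH holds $K_a$ and $K_b$. Keys are shared between parties as follows: $K_b$ between KH and helper; $K_2$ and $K_5$ between EVH and helper; $K_6$ and $K_8$ between EVH and KH; $K_7$ between KH and helper. - The EVH sends $ENC_{K_a}(a)$ to the helper and $ENC_{K_b\oplus K_2}(b)=ENC_{K_b}(b)\oplus K_2$ to the KH. - The KH sends $ENC_{K_6}(K_a)$ to the helper. - The helper sends $ENC_{K_5}(K_b\oplus K_2)$ to the KH. - The EVH computes $t_0:=ENC_{K_a}(a)\wedge ENC_{K_b\oplus K_2}(b)$. - The helper computes $t_1:=ENC_{K_a}(a)\wedge (K_b\oplus K_2)$ and $t_4:=t_1\oplus ENC_{K_6}(K_a)\wedge (K_b\oplus K_2)$, and sends $ENC_{K_7}(t_4)$ to the EVH. - The KH computes $t_2:=K_a\wedge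 ENC_{K_b\oplus K_2}(b)$, $t_3:=K_6\wedge ENC_{K_5}(K_b\oplus K_2)$ and the final key $K_f:=t_2\oplus t_3\oplus K_7\oplus K_8$. - The EVH computes the final encrypted value $t_0\oplus (K_5\wedge K_6)\oplus ENC_{K_7}(t_4)\oplus K_8$. *)

theory Defs
  imports "HOL-Library.Z2"
begin

unbundle bit_operations_syntax

definition ENC :: "bit \<Rightarrow> bit \<Rightarrow> bit" where
  "ENC K m = K XOR m"

definition DEC :: "bit \<Rightarrow> bit \<Rightarrow> bit" where
  "DEC K c = c XOR K"

text \<open>
  Local computations of the parties: the encrypted value holder (\<open>evh\<close>), the key holder (\<open>kh\<close>)
  and the helper. Each takes only values that its party initially holds, shares as a key, or has
  received: \<open>ea\<close> and \<open>eb\<close> are the encryptions of the two inputs, \<open>ebK2\<close> is the message from the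
  EVH to the KH, and the arguments \<open>cj\<close> are the messages masked with the key \<open>Kj\<close>.
\<close>

definition evh_to_kh :: "bit \<Rightarrow> bit \<Rightarrow> bit" where
  "evh_to_kh eb K2 = eb XOR K2"

definition kh_to_helper :: "bit \<Rightarrow> bit \<Rightarrow> bit" where
  "kh_to_helper Ka K6 = ENC K6 Ka"

definition helper_to_kh :: "bit \<Rightarrow> bit \<Rightarrow> bit \<Rightarrow> bit" where
  "helper_to_kh Kb K2 K5 = ENC K5 (Kb XOR K2)"

definition helper_to_evh :: "bit \<Rightarrow> bit \<Rightarrow> bit \<Rightarrow> bit \<Rightarrow> bit \<Rightarrow> bit" where
  "helper_to_evh Kb K2 K7 ea c6 =
    (let t1 = ea AND (Kb XOR K2);
         t4 = t1 XOR (c6 AND (Kb XOR K2))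
     in ENC K7 t4)"

definition kh_final_key :: "bit \<Rightarrow> bit \<Rightarrow> bit \<Rightarrow> bit \<Rightarrow> bit \<Rightarrow> bit \<Rightarrow> bit" where
  "kh_final_key Ka K6 K7 K8 ebK2 c5 =
    (let t2 = Ka AND ebK2;
         t3 = K6 AND c5
     in t2 XOR t3 XOR K7 XOR K8)"

definition evh_final_value :: "bit \<Rightarrow> bit \<Rightarrow> bit \<Rightarrow> bit \<Rightarrow> bit \<Rightarrow> bit \<Rightarrow> bit \<Rightarrow> bit" where
  "evh_final_value ea eb K2 K5 K6 K8 c7 =
    (let t0 = ea AND (eb XOR K2)
     in t0 XOR (K5 AND K6) XOR c7 XOR K8)"

text \<open>
  A run of the protocol, returning the final value of the EVH and the final key of the KH.
\<close>

definition and_protocol ::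
  "bit \<Rightarrow> bit \<Rightarrow> bit \<Rightarrow> bit \<Rightarrow> bit \<Rightarrow> bit \<Rightarrow> bit \<Rightarrow> bit \<Rightarrow> bit \<Rightarrow> bit \<times> bit" where
  "and_protocol a b Ka Kb K2 K5 K6 K7 K8 =
    (let ea = ENC Ka a;
         eb = ENC Kb b;
         ebK2 = evh_to_kh eb K2;
         c6 = kh_to_helper Ka K6;
         c5 = helper_to_kh Kb K2 K5;
         c7 = helper_to_evh Kb K2 K7 ea c6
     in (evh_final_value ea eb K2 K5 K6 K8 c7, kh_final_key Ka K6 K7 K8 ebK2 c5))"

text \<open>The message from the EVH to the KH is the encryption of \<open>b\<close> under the key \<open>Kb XOR K2\<close>.\<close>

lemma evh_to_kh_eq_ENC: "evh_to_kh (ENC Kb b) K2 = ENC (Kb XOR K2) b"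
  by (simp add: evh_to_kh_def ENC_def ac_simps del: xor_bit_def)

end

theory Submission
  imports Defs
begin

text \<open>
  Over the two-element field, with \<open>k = Kb + K2\<close>, the masks \<open>K7\<close> and \<open>K8\<close> cancel and the decrypted
  value is \<open>(Ka + a) (b + k) + K5 K6 + (Ka + a) k + (K6 + Ka) k + Ka (b + k) + K6 (K5 + k)\<close>,
  in which every monomial except \<open>a b\<close> occurs an even number of times.
\<close>

theorem theorem3:
  fixes a b Ka Kb K2 K5 K6 K7 K8 :: bit
  shows "let (v, Kf) = and_protocol a b Ka Kb K2 K5 K6 K7 K8 in DEC Kf v = a AND b"
proof -
  \<comment> \<open>Characteristic two, in two forms: in a sorted, right-nested sum,
    \<open>self\<close> removes an equal pair at the end and \<open>cancel\<close> one further
    inside.\<close>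
  have self: "x + x = 0" and cancel: "x + (x + y) = y" for x y :: bit
    by (cases x; cases y; simp)+
  show ?thesis
    \<comment> \<open>The two reversed equations restate XOR and AND as ring operations, so that
      distributivity becomes available.\<close>
    unfolding and_protocol_def evh_to_kh_def kh_to_helper_def helper_to_kh_def
      helper_to_evh_def kh_final_key_def evh_final_value_def ENC_def DEC_def
      Let_def prod.case add_bit_eq_xor [symmetric] mult_bit_eq_and [symmetric]
    \<comment> \<open>Expanding and ordered rewriting bring equal monomials next to each other,
      where they cancel in pairs.\<close>
    by (simp only: algebra_simps self cancel add_0_left add_0_right)
qed

end
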